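(* Let $d\ge 1$ and $k\ge 2$ be integers, let $m>2$ be an integer, and put $r=\binom{k+d}{d}-1$. For any cube $B\subseteq [0,1]^{d}$ of side length $\frac{1}{h}$ and any $F \in \mathbb{Z}_m[X_1,\dots, X_d ]$ of degree $k$ with $g_F=1$, we have $$N_F(B)\le \left(\frac{m}{h}\right)^{d-\frac{k}{2r(k+1)}+o(1)}+m^{d-\frac{1}{2r(k+1)}+o(1)}\left(\frac{1}{h}\right)^{d+o(1)}$$ as $\dfrac{m}{h} \rightarrow \infty$.
   Context: $\mathbb{Z}_m=\mathbb{Z}/m\mathbb{Z}$. For $\Omega\subseteq[0,1]^d$, $N_F(\Omega)$ denotes the number of $\mathbf{x}=(x_1,\dots,x_d)\in\mathbb{Z}^d$ with $F(\mathbf{x})\equiv 0 \pmod m$ and $\left(\frac{x_1}{m},\dots,\frac{x_d}{m}\right)\in\Omega$. A cube of side length $1/h$ is a product of $d$ intervals each of length $1/h$. For a $d$-tuple of non-negative integers $\mathbf{i}=(i_1,\dots,i_d)$ write $\mathbf{x}^{\mathbf{i}}=x_1^{i_1}\cdots x_d^{i_d}$ and $|\mathbf{i}|=i_1+\dots+i_d$. For $F=\sum_{0\le|\mathbf{i}|\le k}\beta_{\mathbf{i}}\mathbf{x}^{\mathbf{i}}$ of degree $k$ define $$g_F=\min_{|\mathbf{i}|=k}\gcd(m,\beta_{\mathbf{i}}).$$ Thus $g_F=1$ means that some coefficient of a monomial of total degree $k$ is coprime to $m$. Convention on $o(1)$: each occurrence (possibly different at each occurrence) denotes a real quantity which is arbitrarily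 small in absolute value once the indicated parameter (here $m/h$) is large enough in terms of $d$ and $k$. That is, for every $\varepsilon>0$ there is $T=T(d,k,\varepsilon)$ such that whenever $m/h\ge T$ the inequality holds with the occurrences of $o(1)$ replaced by some real numbers in $[-\varepsilon,\varepsilon]$. *)

theory Defs
  imports "HOL-Analysis.Analysis" "HOL-Library.Poly_Mapping" "HOL-Number_Theory.Cong"
begin

text \<open>
  A polynomial in variables indexed by the finite type \<open>'d\<close> is a finitely supported map from
  exponent vectors to coefficients. There is no type of integers modulo a variable \<open>m\<close>, so an
  element of \<open>\<int>\<^sub>m[X\<^sub>1,\<dots>,X\<^sub>d]\<close> is represented by an arbitrary integer polynomial lifting it. The
  notions \<open>deg_mod\<close>, \<open>top_gcd\<close> and \<open>count_sols\<close> below depend only on the residue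
  classes of the coefficients modulo \<open>m\<close>.
\<close>

type_synonym 'd int_mpoly = "(nat ^ 'd) \<Rightarrow>\<^sub>0 int"

definition mon_deg :: "nat ^ 'd::finite \<Rightarrow> nat" where
  "mon_deg i = (\<Sum>j\<in>UNIV. i $ j)"

definition eval_mpoly :: "'d::finite int_mpoly \<Rightarrow> int ^ 'd \<Rightarrow> int" where
  "eval_mpoly F x =
     (\<Sum>i\<in>Poly_Mapping.keys F. Poly_Mapping.lookup F i * (\<Prod>j\<in>UNIV. (x $ j) ^ (i $ j)))"

text \<open>The total degree over \<open>\<int>\<^sub>m\<close>: monomials whose coefficient vanishes modulo \<open>m\<close> do not count.
  Inserting \<open>0\<close> only gives the zero polynomial degree \<open>0\<close>.\<close>

definition deg_mod :: "int \<Rightarrow> 'd::finite int_mpoly \<Rightarrow> nat" where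
  "deg_mod m F = Max (insert 0 (mon_deg ` {i. \<not> m dvd Poly_Mapping.lookup F i}))"

text \<open>The quantity \<open>g\<^sub>F\<close>. The minimum is over all exponent vectors of top total degree; those
  whose coefficient is zero contribute \<open>gcd m 0 = m\<close>.\<close>

definition top_gcd :: "int \<Rightarrow> 'd::finite int_mpoly \<Rightarrow> int" where
  "top_gcd m F =
     Min ((\<lambda>i. gcd m (Poly_Mapping.lookup F i)) ` {i. mon_deg i = deg_mod m F})"

text \<open>The quantity \<open>N\<^sub>F(\<Omega>)\<close>. The set counted is finite whenever \<open>\<Omega>\<close> is bounded and \<open>m \<noteq> 0\<close>.\<close>

definition count_sols :: "int \<Rightarrow> 'd::finite int_mpoly \<Rightarrow> (real ^ 'd) set \<Rightarrow> nat" where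
  "count_sols m F \<Omega> =
     card {x :: int ^ 'd. [eval_mpoly F x = 0] (mod m) \<and>
                          (\<chi> j. real_of_int (x $ j) / real_of_int m) \<in> \<Omega>}"

text \<open>Intervals may be open, closed or half-open, independently in each coordinate.\<close>

definition interval_of_length :: "real \<Rightarrow> real set \<Rightarrow> bool" where
  "interval_of_length l I \<longleftrightarrow>
     (\<exists>a. I \<in> {{a..a + l}, {a..<a + l}, {a<..a + l}, {a<..<a + l}})"

definition cube :: "real \<Rightarrow> (real ^ 'd::finite) set \<Rightarrow> bool" where
  "cube l B \<longleftrightarrow>
     (\<exists>I :: 'd \<Rightarrow> real set. (\<forall>j. interval_of_length l (I j)) \<and> B = {x. \<forall>j. x $ j \<in> I j})"

end

theory Submission
  imports Defs
begin

text \<open>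
  Put \<open>H = m / h\<close> and cut the box into cells of side \<open>L\<close>, where \<open>L\<close> is about the minimum of \<open>H\<close>
  and \<open>(m / (2 A))\<^bsup>1/S\<^esup>\<close> with \<open>S = 2r(k+1)\<close> and \<open>A = (r+1)\<^bsup>r+1\<^esup>\<close>. Translate a cell to the origin, which does not
  change the coefficients of degree \<open>k\<close> modulo \<open>m\<close>. The pigeonhole principle gives \<open>0 < c < m\<close> such that
  \<open>c F\<close> is congruent to a polynomial \<open>G\<close> whose coefficients are so small that \<open>\<bar>G\<bar> < m\<close> on the cell. Hence the
  solutions in the cell are honest integer zeros of \<open>G\<close>, and \<open>G \<noteq> 0\<close> since \<open>F\<close> has a coefficient
  coprime to \<open>m\<close>, so a Schwartz--Zippel count leaves at most \<open>d k L\<^bsup>d-1\<^esup>\<close> of them. Such a \<open>G\<close> exists for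
  this \<open>L\<close> because the degrees of the at most \<open>r + 1\<close> monomials of degree at most \<open>k\<close> sum to at most
  \<open>k r \<le> S\<close>. Summing over cells gives \<open>O(H\<^sup>d / L)\<close> solutions, that is
  \<open>O(H\<^bsup>d-1\<^esup> + H\<^sup>d m\<^bsup>-1/S\<^esup>)\<close>. No mean value theorem of Vinogradov type is involved.
\<close>

section \<open>Zeros of a polynomial on a grid\<close>

text \<open>Schwartz--Zippel with degree at most \<open>k\<close> in each variable, by induction on
  the set of variables. The exponent \<open>e\<close> of a nonzero coefficient tells which
  coefficient polynomial is nonzero once a variable is split off. The factor \<open>card A\<close>
  on the left avoids the exponent \<open>card J - 1\<close>.\<close>

lemma card_grid_zeros_le:
  fixes c :: "('d \<Rightarrow> nat) \<Rightarrow> 'a::idom" and k :: nat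
  assumes "finite J" "finite A" "e \<in> PiE J (\<lambda>_. {..k})" "c e \<noteq> 0"
  shows "card {y \<in> PiE J (\<lambda>_. A). (\<Sum>e\<in>PiE J (\<lambda>_. {..k}). c e * (\<Prod>j\<in>J. y j ^ e j)) = 0} * card A
         \<le> card J * k * card A ^ card J"
  using assms(1,3,4)
proof (induction J arbitrary: c e rule: finite_induct)
  case empty
  then show ?case by simp
next
  case (insert a J)
  \<comment> \<open>\<open>P t\<close> is the coefficient of \<open>y a ^ t\<close> when the
    polynomial is read as one in the variable indexed by \<open>a\<close>.\<close>
  define P where "P t y = (\<Sum>e\<in>PiE J (\<lambda>_. {..k}). c (e(a := t)) * (\<Prod>j\<in>J. y j ^ e j))" for t y
  have P_cong: "P t (y(a := v)) = P t y" for t y v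
    unfolding P_def using insert.hyps by (intro sum.cong refl arg_cong2[where f="(*)"] prod.cong) auto
  have expand: "(\<Sum>e\<in>PiE (insert a J) (\<lambda>_. {..k}). c e * (\<Prod>j\<in>insert a J. y j ^ e j))
      = (\<Sum>t\<le>k. P t y * y a ^ t)" for y
  proof -
    have "(\<Sum>e\<in>PiE (insert a J) (\<lambda>_. {..k}). c e * (\<Prod>j\<in>insert a J. y j ^ e j))
      = (\<Sum>(t, e)\<in>{..k} \<times> PiE J (\<lambda>_. {..k}). c (e(a := t)) * (\<Prod>j\<in>insert a J. y j ^ (e(a := t)) j))"
      unfolding PiE_insert_eq using insert.hyps
      by (subst sum.reindex[OF inj_combinator]) (auto simp: case_prod_unfold)
    also have "\<dots> = (\<Sum>t\<le>k. \<Sum>e\<in>PiE J (\<lambda>_. {..k}). c (e(a := t)) * (\<Prod>j\<in>insert a J. y j ^ (e(a := t)) j))"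
      by (simp add: sum.cartesian_product)
    also have "\<dots> = (\<Sum>t\<le>k. P t y * y a ^ t)"
      unfolding P_def sum_distrib_right
    proof (intro sum.cong refl)
      fix t e
      have "(\<Prod>j\<in>J. y j ^ (e(a := t)) j) = (\<Prod>j\<in>J. y j ^ e j)"
        using insert.hyps by (intro prod.cong) auto
      then show "c (e(a := t)) * (\<Prod>j\<in>insert a J. y j ^ (e(a := t)) j) =
          c (e(a := t)) * (\<Prod>j\<in>J. y j ^ e j) * y a ^ t"
        using insert.hyps by (simp add: mult_ac)
    qed
    finally show ?thesis .
  qed
  obtain t e' where te: "e = e'(a := t)" "t \<le> k" "e' \<in> PiE J (\<lambda>_. {..k})"
    using insert.prems(1) unfolding PiE_insert_eq by auto
  \<comment> \<open>Over \<open>Z\<close> every value in \<open>A\<close> is allowed for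
    \<open>y a\<close>. Off \<open>Z\<close> the polynomial in \<open>y a\<close> is nonzero, so at
    most \<open>k\<close> values remain; these pairs form \<open>W\<close>.\<close>
  define Z where "Z = {y \<in> PiE J (\<lambda>_. A). P t y = 0}"
  have fin: "finite (PiE J (\<lambda>_. A))" using insert.hyps assms(2) by (intro finite_PiE) auto
  have Z: "card Z * card A \<le> card J * k * card A ^ card J" "finite Z"
    unfolding Z_def P_def using insert.IH[OF te(3), of "\<lambda>e. c (e(a := t))"] insert.prems(2) fin
    unfolding te(1) by (blast, simp)
  define R where "R y = {v \<in> A. (\<Sum>s\<le>k. P s y * v ^ s) = 0}" for y
  define W where "W = Sigma (PiE J (\<lambda>_. A) - Z) R"
  have R: "card (R y) \<le> k" if "y \<in> PiE J (\<lambda>_. A) - Z" for y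
  proof -
    define p where "p = (\<Sum>s\<le>k. monom (P s y) s)"
    have poly_p: "poly p v = (\<Sum>s\<le>k. P s y * v ^ s)" for v
      by (simp add: p_def poly_sum poly_monom)
    have "coeff p t = P t y"
      using te(2) by (simp add: p_def coeff_sum)
    then have nz: "p \<noteq> 0" using that by (auto simp: Z_def)
    have "card (R y) \<le> card {v. poly p v = 0}"
      unfolding R_def poly_p[symmetric] using poly_roots_finite[OF nz] by (intro card_mono) auto
    also have "\<dots> \<le> degree p" using nz by (rule card_poly_roots_bound)
    also have "\<dots> \<le> k"
      unfolding p_def by (intro degree_sum_le) (auto intro: order_trans[OF degree_monom_le])
    finally show ?thesis .
  qed
  have finR: "finite (R y)" for y using assms(2) by (simp add: R_def)
  have "card W = (\<Sum>y\<in>PiE J (\<lambda>_. A) - Z. card (R y))"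
    unfolding W_def using fin finR by (subst card_SigmaI) auto
  also have "\<dots> \<le> of_nat (card (PiE J (\<lambda>_. A) - Z)) * k"
    using R by (rule sum_bounded_above)
  also have "\<dots> \<le> card A ^ card J * k"
    using card_mono[OF fin, of "PiE J (\<lambda>_. A) - Z"] insert.hyps
    by (auto simp: card_PiE)
  finally have W: "card W \<le> card A ^ card J * k" .
  have finW: "finite W" unfolding W_def using fin finR by auto
  have "{y \<in> PiE (insert a J) (\<lambda>_. A). (\<Sum>t\<le>k. P t y * y a ^ t) = 0}
      \<subseteq> (\<lambda>(y, v). y(a := v)) ` (Z \<times> A \<union> W)"
  proof
    fix y assume y: "y \<in> {y \<in> PiE (insert a J) (\<lambda>_. A). (\<Sum>t\<le>k. P t y * y a ^ t) = 0}"
    then obtain v y' where v: "y = y'(a := v)" "v \<in> A" "y' \<in> PiE J (\<lambda>_. A)"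
      unfolding PiE_insert_eq by auto
    then have "(y', v) \<in> Z \<times> A \<union> W"
      using y P_cong by (auto simp: W_def R_def)
    then show "y \<in> (\<lambda>(y, v). y(a := v)) ` (Z \<times> A \<union> W)"
      using v(1) by force
  qed
  then have "card {y \<in> PiE (insert a J) (\<lambda>_. A). (\<Sum>t\<le>k. P t y * y a ^ t) = 0}
      \<le> card (Z \<times> A \<union> W)"
    using Z(2) finW assms(2) by (intro surj_card_le) auto
  also have "\<dots> \<le> card Z * card A + card W"
    using card_Un_le[of "Z \<times> A" W] by (simp add: card_cartesian_product)
  also have "\<dots> \<le> card J * k * card A ^ card J + card A ^ card J * k"
    using Z(1) W by (rule add_mono)
  finally have "card {y \<in> PiE (insert a J) (\<lambda>_. A). (\<Sum>t\<le>k. P t y * y a ^ t) = 0} * card A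
      \<le> (card J * k * card A ^ card J + card A ^ card J * k) * card A"
    by (rule mult_le_mono1)
  also have "\<dots> = card (insert a J) * k * card A ^ card (insert a J)"
    using insert.hyps by (simp add: algebra_simps)
  finally show ?case unfolding expand .
qed

section \<open>Multiples with small residues\<close>

text \<open>Simultaneous approximation in the manner of Dirichlet: the \<open>m\<close> multipliers
  in \<open>{0..<m}\<close> fall into fewer than \<open>m\<close> boxes, and the difference of two
  that share a box serves as \<open>c\<close>.\<close>

lemma small_multiple_mod:
  fixes \<beta> :: "'i \<Rightarrow> int" and N :: "'i \<Rightarrow> nat" and m :: int
  assumes fin: "finite I" and pos: "\<And>e. e \<in> I \<Longrightarrow> N e > 0" and lt: "int (\<Prod>e\<in>I. N e) < m"
  obtains c \<gamma> where "0 < c" "c < m" "\<And>e. e \<in> I \<Longrightarrow> [\<gamma> e = c * \<beta> e] (mod m)"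
    "\<And>e. e \<in> I \<Longrightarrow> \<bar>\<gamma> e\<bar> * int (N e) < m"
proof -
  have m: "m > 0" using lt by (meson of_nat_0_le_iff order_le_less_trans)
  \<comment> \<open>Cut \<open>[0, m)\<close> into \<open>N e\<close> pieces of length
    \<open>m / N e\<close>; this is the index, from 0, of the piece holding the residue of
    \<open>c * \<beta> e\<close>.\<close>
  define q where "q c e = (c * \<beta> e) mod m * int (N e) div m" for c e
  have q: "0 \<le> q c e" "q c e < int (N e)" if "e \<in> I" for c e
  proof -
    have "(c * \<beta> e) mod m * int (N e) < m * int (N e)"
      using m pos[OF that] by (intro mult_strict_right_mono) auto
    then show "q c e < int (N e)"
      using m unfolding q_def
      by (smt (verit) div_mult_mod_eq mult.commute mult_less_cancel_right pos_mod_sign)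
    show "0 \<le> q c e"
      using m by (simp add: q_def pos_imp_zdiv_nonneg_iff)
  qed
  define f where "f c = (\<lambda>e\<in>I. nat (q c e))" for c
  have "card (f ` {0..<m}) \<le> card (PiE I (\<lambda>e. {..<N e}))"
    using q fin by (intro card_mono finite_PiE) (auto simp: f_def nat_less_iff)
  also have "\<dots> = (\<Prod>e\<in>I. N e)" using fin by (simp add: card_PiE)
  also have "\<dots> < card {0..<m}" using lt m by (simp add: zless_nat_eq_int_zless)
  finally have "\<not> inj_on f {0..<m}"
    using pigeonhole by blast
  then obtain a b where ab: "0 \<le> a" "a < b" "b < m" "f a = f b"
    by (metis atLeastLessThan_iff linorder_inj_onI' linorder_neqE)
  show ?thesis
  proof
    show "0 < b - a" "b - a < m" using ab by auto
    define \<gamma> where "\<gamma> e = (b * \<beta> e) mod m - (a * \<beta> e) mod m" for e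
    show "[\<gamma> e = (b - a) * \<beta> e] (mod m)" for e
      unfolding \<gamma>_def cong_def left_diff_distrib by (simp add: mod_diff_eq)
    show "\<bar>\<gamma> e\<bar> * int (N e) < m" if "e \<in> I" for e
    proof -
      have "nat (q a e) = nat (q b e)"
        using fun_cong[OF ab(4), of e] that by (simp add: f_def)
      then have "q a e = q b e" using q[OF that] by (metis nat_0_le)
      then have eq: "(a * \<beta> e) mod m * int (N e) div m = (b * \<beta> e) mod m * int (N e) div m"
        by (simp add: q_def)
      \<comment> \<open>Used with \<open>x\<close> and \<open>y\<close> the two residues times
        \<open>N e\<close>, where sharing a piece means equal quotients by \<open>m\<close>.\<close>
      have near: "\<bar>x - y\<bar> < m" if "x div m = y div m" for x y :: int
        using that m pos_mod_bound[of m x] pos_mod_bound[of m y] pos_mod_sign[of m x]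
          pos_mod_sign[of m y] div_mult_mod_eq[of x m] div_mult_mod_eq[of y m] by (smt (verit))
      show ?thesis
        using near[OF eq[symmetric]]
        by (simp add: \<gamma>_def abs_mult left_diff_distrib flip: left_diff_distrib)
    qed
  qed
qed

section \<open>Exponent vectors of bounded total degree\<close>

text \<open>Exponents are plain functions here, not vectors, so that \<open>PiE\<close> and the grid
  count apply to them directly.\<close>

definition exps :: "nat \<Rightarrow> ('d::finite \<Rightarrow> nat) set" where
  "exps k = {e. sum e UNIV \<le> k}"

lemma exps_le: "e \<in> exps k \<Longrightarrow> e j \<le> k"
  using member_le_sum[of j UNIV e] by (simp add: exps_def)

lemma exps_subset_PiE: "exps k \<subseteq> PiE UNIV (\<lambda>_. {..k})"
  using exps_le by auto

lemma finite_exps: "finite (exps k)"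
  by (rule finite_subset[OF exps_subset_PiE]) (simp add: finite_PiE)

text \<open>Stars and bars: putting the slack \<open>k - sum e UNIV\<close> in front turns exponents
  injectively into lists of length \<open>CARD('d) + 1\<close> with sum \<open>k\<close>.\<close>

lemma card_exps_le: "card (exps k :: ('d::finite \<Rightarrow> nat) set) \<le> (k + CARD('d)) choose CARD('d)"
proof -
  obtain us where us: "set us = (UNIV :: 'd set)" "distinct us"
    using finite_distinct_list[of "UNIV :: 'd set"] by auto
  have len: "length us = CARD('d)" using us distinct_card by fastforce
  define f where "f e = (k - sum e UNIV) # map e us" for e :: "'d \<Rightarrow> nat"
  define X where "X = {l::nat list. size l = Suc CARD('d) \<and> sum_list l = k}"
  have X: "card X = (k + CARD('d)) choose k"
    unfolding X_def card_length_sum_list by simp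
  have "inj f"
    using us by (auto simp: inj_def f_def fun_eq_iff)
  moreover have "f ` exps k \<subseteq> X"
    using us len by (auto simp: f_def X_def exps_def sum_list_distinct_conv_sum_set)
  moreover have "finite X"
    using X by (intro card_ge_0_finite) simp
  ultimately have "card (exps k :: ('d \<Rightarrow> nat) set) \<le> card X"
    by (metis card_inj_on_le inj_on_subset subset_UNIV)
  then show ?thesis
    unfolding X by (metis binomial_symmetric diff_add_inverse le_add1)
qed

text \<open>The zero exponent contributes nothing, and each of the others at most
  \<open>k\<close>.\<close>

lemma sum_exps_le: "(\<Sum>e\<in>(exps k :: ('d::finite \<Rightarrow> nat) set). sum e UNIV) \<le> k * (card (exps k :: ('d::finite \<Rightarrow> nat) set) - 1)"
proof -
  have 0: "(\<lambda>_. 0) \<in> (exps k :: ('d \<Rightarrow> nat) set)" by (simp add: exps_def)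
  have "(\<Sum>e\<in>(exps k :: ('d \<Rightarrow> nat) set). sum e UNIV) = (\<Sum>e\<in>exps k - {\<lambda>_::'d. 0}. sum e UNIV)"
    using finite_exps by (intro sum.mono_neutral_right) auto
  also have "\<dots> \<le> of_nat (card (exps k - {\<lambda>_::'d. 0})) * k"
    by (rule sum_bounded_above) (auto simp: exps_def)
  also have "card (exps k - {\<lambda>_::'d. 0}) = card (exps k :: ('d \<Rightarrow> nat) set) - 1"
    using 0 finite_exps by simp
  finally show ?thesis by (simp add: mult.commute)
qed

section \<open>Solutions in one small cell at the origin\<close>

text \<open>The pigeonhole weights \<open>card (exps k) * L ^ sum e UNIV\<close> make each term of
  the new polynomial smaller than \<open>m / card (exps k)\<close> on the cell. Its values are then
  below \<open>m\<close> in absolute value, so vanishing modulo \<open>m\<close> is vanishing, and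
  the grid count applies.\<close>

lemma card_small_box_le:
  fixes \<beta> :: "('d::finite \<Rightarrow> nat) \<Rightarrow> int" and L k :: nat
  assumes e0: "e0 \<in> exps k" "coprime (\<beta> e0) m" and L: "L > 0"
    and small: "int (\<Prod>e\<in>(exps k :: ('d \<Rightarrow> nat) set). card (exps k :: ('d \<Rightarrow> nat) set) * L ^ sum e UNIV) < m"
  shows "card {y. (\<forall>j. y j \<in> {0..<int L}) \<and> [(\<Sum>e\<in>exps k. \<beta> e * (\<Prod>j\<in>UNIV. y j ^ e j)) = 0] (mod m)} * L
    \<le> CARD('d) * k * L ^ CARD('d)"
proof -
  let ?I = "exps k :: ('d \<Rightarrow> nat) set"
  have card_pos: "card ?I > 0" using e0 finite_exps card_gt_0_iff by blast
  obtain c \<gamma> where c: "0 < c" "c < m" and \<gamma>: "\<And>e. e \<in> ?I \<Longrightarrow> [\<gamma> e = c * \<beta> e] (mod m)"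
    "\<And>e. e \<in> ?I \<Longrightarrow> \<bar>\<gamma> e\<bar> * int (card ?I * L ^ sum e UNIV) < m"
    using small_multiple_mod[OF finite_exps _ small, of \<beta>] L card_pos by auto
  \<comment> \<open>As \<open>\<beta> e0\<close> is coprime to \<open>m\<close>, \<open>m\<close>
    cannot divide \<open>c * \<beta> e0\<close>; hence the small polynomial is not zero.\<close>
  have "\<not> m dvd c" using c zdvd_not_zless by blast
  then have nz: "\<gamma> e0 \<noteq> 0"
    using \<gamma>(1)[OF e0(1)] e0(2)
    by (metis cong_0_iff cong_sym coprime_commute coprime_dvd_mult_left_iff)
  \<comment> \<open>The grid count runs over the full cube of exponents, so the coefficients are
    padded with 0 outside \<open>exps k\<close>.\<close>
  define \<gamma>' where "\<gamma>' e = (if e \<in> ?I then \<gamma> e else 0)" for e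
  have G: "(\<Sum>e\<in>PiE UNIV (\<lambda>_. {..k}). \<gamma>' e * (\<Prod>j\<in>UNIV. y j ^ e j))
      = (\<Sum>e\<in>?I. \<gamma> e * (\<Prod>j\<in>UNIV. y j ^ e j))" for y :: "'d \<Rightarrow> int"
    using exps_subset_PiE[of k]
    by (intro sum.mono_neutral_cong_right) (auto simp: \<gamma>'_def finite_PiE)
  define Y where "Y = {y \<in> PiE UNIV (\<lambda>_. {0..<int L}).
      (\<Sum>e\<in>PiE UNIV (\<lambda>_. {..k}). \<gamma>' e * (\<Prod>j\<in>UNIV. y j ^ e j)) = 0}"
  have "{y. (\<forall>j. y j \<in> {0..<int L}) \<and> [(\<Sum>e\<in>?I. \<beta> e * (\<Prod>j\<in>UNIV. y j ^ e j)) = 0] (mod m)} \<subseteq> Y"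
  proof
    fix y assume y: "y \<in> {y. (\<forall>j. y j \<in> {0..<int L}) \<and> [(\<Sum>e\<in>?I. \<beta> e * (\<Prod>j\<in>UNIV. y j ^ e j)) = 0] (mod m)}"
    define G where "G = (\<Sum>e\<in>?I. \<gamma> e * (\<Prod>j\<in>UNIV. y j ^ e j))"
    have mon: "\<bar>\<Prod>j\<in>UNIV. y j ^ e j\<bar> \<le> int L ^ sum e UNIV" for e
      unfolding abs_prod power_sum using y
      by (intro prod_mono) (auto simp: power_abs less_imp_le intro!: power_mono)
    \<comment> \<open>Scaling by \<open>card ?I\<close> keeps the estimate in the integers: it
      becomes a sum of \<open>card ?I\<close> terms, each below \<open>m\<close>.\<close>
    have "int (card ?I) * \<bar>G\<bar> \<le> int (card ?I) * (\<Sum>e\<in>?I. \<bar>\<gamma> e * (\<Prod>j\<in>UNIV. y j ^ e j)\<bar>)"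
      unfolding G_def by (intro mult_left_mono sum_abs) auto
    also have "\<dots> \<le> int (card ?I) * (\<Sum>e\<in>?I. \<bar>\<gamma> e\<bar> * int L ^ sum e UNIV)"
      unfolding abs_mult using mon by (intro mult_left_mono sum_mono) auto
    also have "\<dots> = (\<Sum>e\<in>?I. \<bar>\<gamma> e\<bar> * int (card ?I * L ^ sum e UNIV))"
      by (simp add: sum_distrib_left mult_ac)
    also have "\<dots> < (\<Sum>e\<in>?I. m)"
      using \<gamma>(2) finite_exps e0 by (intro sum_strict_mono) auto
    finally have lt: "\<bar>G\<bar> < m" using card_pos by simp
    have "[G = (\<Sum>e\<in>?I. c * \<beta> e * (\<Prod>j\<in>UNIV. y j ^ e j))] (mod m)"
      unfolding G_def using \<gamma>(1) by (intro cong_sum cong_mult) auto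
    also have "(\<Sum>e\<in>?I. c * \<beta> e * (\<Prod>j\<in>UNIV. y j ^ e j)) = c * (\<Sum>e\<in>?I. \<beta> e * (\<Prod>j\<in>UNIV. y j ^ e j))"
      by (simp add: sum_distrib_left mult_ac)
    also have "[\<dots> = c * 0] (mod m)" using y by (intro cong_mult) auto
    finally have "m dvd G" by (simp add: cong_0_iff)
    then have "G = 0" using lt zdvd_not_zless[of "\<bar>G\<bar>" m] by auto
    then show "y \<in> Y" using y unfolding Y_def G_def G by auto
  qed
  moreover have "finite Y" unfolding Y_def by (simp add: finite_PiE)
  ultimately have "card {y. (\<forall>j. y j \<in> {0..<int L}) \<and> [(\<Sum>e\<in>?I. \<beta> e * (\<Prod>j\<in>UNIV. y j ^ e j)) = 0] (mod m)} * L
     \<le> card Y * L" by (intro mult_le_mono1 card_mono)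
  also have "\<dots> \<le> CARD('d) * k * L ^ CARD('d)"
    using card_grid_zeros_le[of "UNIV :: 'd set" "{0..<int L}" e0 k \<gamma>'] e0 nz exps_subset_PiE
    unfolding Y_def by (auto simp: \<gamma>'_def)
  finally show ?thesis .
qed

section \<open>Translating a polynomial\<close>

text \<open>The binomial theorem in each coordinate. The index set can be the same for all
  \<open>i\<close>: if \<open>e j > i j\<close> for some \<open>j\<close>, then a binomial
  coefficient vanishes, which also disarms the truncated subtraction.\<close>

lemma prod_shift_expand:
  fixes a y :: "'d::finite \<Rightarrow> int" and i :: "'d \<Rightarrow> nat"
  assumes "i \<in> exps k"
  shows "(\<Prod>j\<in>UNIV. (a j + y j) ^ i j)
    = (\<Sum>e\<in>exps k. (\<Prod>j\<in>UNIV. int (i j choose e j) * a j ^ (i j - e j)) * (\<Prod>j\<in>UNIV. y j ^ e j))"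
proof -
  have "(a j + y j) ^ i j = (\<Sum>t\<le>k. int (i j choose t) * a j ^ (i j - t) * y j ^ t)" for j
  proof -
    have "(a j + y j) ^ i j = (\<Sum>t\<le>i j. int (i j choose t) * a j ^ (i j - t) * y j ^ t)"
      using binomial_ring[of "y j" "a j" "i j"] by (simp add: add.commute mult_ac)
    also have "\<dots> = (\<Sum>t\<le>k. int (i j choose t) * a j ^ (i j - t) * y j ^ t)"
      using exps_le[OF assms, of j] by (intro sum.mono_neutral_left) (auto simp: binomial_eq_0)
    finally show ?thesis .
  qed
  then have "(\<Prod>j\<in>UNIV. (a j + y j) ^ i j)
    = (\<Sum>e\<in>PiE UNIV (\<lambda>_. {..k}). \<Prod>j\<in>UNIV. int (i j choose e j) * a j ^ (i j - e j) * y j ^ e j)"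
    by (simp add: prod_sum_PiE)
  also have "\<dots> = (\<Sum>e\<in>exps k. \<Prod>j\<in>UNIV. int (i j choose e j) * a j ^ (i j - e j) * y j ^ e j)"
  proof (intro sum.mono_neutral_right ballI)
    fix e :: "'d \<Rightarrow> nat" assume "e \<in> PiE UNIV (\<lambda>_. {..k}) - exps k"
    then have "sum i UNIV < sum e UNIV" using assms by (auto simp: exps_def)
    then obtain j where "i j < e j" by (meson not_le sum_mono)
    then show "(\<Prod>j\<in>UNIV. int (i j choose e j) * a j ^ (i j - e j) * y j ^ e j) = 0"
      by (intro prod_zero) (auto intro!: exI[of _ j])
  qed (use exps_subset_PiE in \<open>auto simp: finite_PiE\<close>)
  finally show ?thesis by (simp add: prod.distrib)
qed

text \<open>Translation fixes top-degree coefficients: a monomial of degree at most that of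
  \<open>e\<close> can contribute to the coefficient at \<open>e\<close> only if it is that monomial
  itself.\<close>

lemma prod_choose_top:
  fixes i e :: "'d::finite \<Rightarrow> nat" and a :: "'d \<Rightarrow> int"
  assumes "sum i UNIV \<le> sum e UNIV" 
  shows "(\<Prod>j\<in>UNIV. int (i j choose e j) * a j ^ (i j - e j)) = (if i = e then 1 else 0)"
proof (cases "i = e")
  case False
  have "\<exists>j. i j < e j"
  proof (rule ccontr)
    assume "\<not> ?thesis"
    then have le: "e j \<le> i j" for j by (meson not_le)
    obtain j where "e j \<noteq> i j" using False by (metis ext)
    then have "sum e UNIV < sum i UNIV" using le
      by (intro sum_strict_mono_ex1) (auto intro!: exI[of _ j] le_neq_implies_less)
    then show False using assms by simp
  qed
  then obtain j where "i j < e j" by blast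
  then show ?thesis using False by (auto intro!: prod_zero exI[of _ j])
qed auto

text \<open>Lets a cell be moved to the origin while the coefficient at \<open>i0\<close>, and with
  it coprimality to \<open>m\<close>, survives.\<close>

lemma eval_mpoly_shift:
  fixes F :: "'d::finite int_mpoly" and a :: "int ^ 'd"
  assumes hi: "\<And>i. mon_deg i > k \<Longrightarrow> m dvd Poly_Mapping.lookup F i" and i0: "mon_deg i0 = k"
  obtains \<beta> where "\<beta> (vec_nth i0) = Poly_Mapping.lookup F i0"
    "\<And>y. [eval_mpoly F (a + y) = (\<Sum>e\<in>exps k. \<beta> e * (\<Prod>j\<in>UNIV. (y $ j) ^ e j))] (mod m)"
proof
  \<comment> \<open>The integer lift may have monomials of degree above \<open>k\<close>; they
    vanish modulo \<open>m\<close> and are dropped.\<close>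
  let ?K = "{i \<in> Poly_Mapping.keys F. mon_deg i \<le> k}"
  define b where "b i e = (\<Prod>j\<in>UNIV. int (i $ j choose e j) * (a $ j) ^ (i $ j - e j))"
    for i :: "nat ^ 'd" and e
  define \<beta> where "\<beta> e = (\<Sum>i\<in>?K. Poly_Mapping.lookup F i * b i e)" for e
  have b: "b i (vec_nth i0) = (if i = i0 then 1 else 0)" if "mon_deg i \<le> k" for i
    using prod_choose_top[of "vec_nth i" "vec_nth i0" "vec_nth a"] that i0
    by (simp add: b_def mon_deg_def vec_nth_inject)
  have "\<beta> (vec_nth i0) = (\<Sum>i\<in>?K. if i = i0 then Poly_Mapping.lookup F i else 0)"
    unfolding \<beta>_def using b by (intro sum.cong) auto
  also have "\<dots> = Poly_Mapping.lookup F i0"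
    using i0 by (simp add: sum.delta in_keys_iff)
  finally show "\<beta> (vec_nth i0) = Poly_Mapping.lookup F i0" .
  show "[eval_mpoly F (a + y) = (\<Sum>e\<in>exps k. \<beta> e * (\<Prod>j\<in>UNIV. (y $ j) ^ e j))] (mod m)" for y
  proof -
    have "[eval_mpoly F (a + y) = (\<Sum>i\<in>Poly_Mapping.keys F. if mon_deg i \<le> k then
        Poly_Mapping.lookup F i * (\<Prod>j\<in>UNIV. (a $ j + y $ j) ^ (i $ j)) else 0)] (mod m)"
      unfolding eval_mpoly_def
    proof (intro cong_sum)
      fix i
      show "[Poly_Mapping.lookup F i * (\<Prod>j\<in>UNIV. (a + y) $ j ^ i $ j) =
         (if mon_deg i \<le> k then Poly_Mapping.lookup F i * (\<Prod>j\<in>UNIV. (a $ j + y $ j) ^ (i $ j)) else 0)] (mod m)"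
        using hi[of i] by (auto simp: cong_0_iff)
    qed
    also have "(\<Sum>i\<in>Poly_Mapping.keys F. if mon_deg i \<le> k then
        Poly_Mapping.lookup F i * (\<Prod>j\<in>UNIV. (a $ j + y $ j) ^ (i $ j)) else 0)
      = (\<Sum>i\<in>?K. Poly_Mapping.lookup F i * (\<Prod>j\<in>UNIV. (a $ j + y $ j) ^ (i $ j)))"
      by (simp add: sum.inter_filter)
    also have "\<dots> = (\<Sum>i\<in>?K. \<Sum>e\<in>exps k. Poly_Mapping.lookup F i * b i e * (\<Prod>j\<in>UNIV. (y $ j) ^ e j))"
    proof (intro sum.cong refl)
      fix i assume "i \<in> ?K"
      then have "vec_nth i \<in> exps k" by (simp add: exps_def mon_deg_def)
      from prod_shift_expand[OF this, of "vec_nth a" "vec_nth y"]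
      show "Poly_Mapping.lookup F i * (\<Prod>j\<in>UNIV. (a $ j + y $ j) ^ (i $ j))
        = (\<Sum>e\<in>exps k. Poly_Mapping.lookup F i * b i e * (\<Prod>j\<in>UNIV. (y $ j) ^ e j))"
        by (simp add: b_def sum_distrib_left mult.assoc)
    qed
    also have "\<dots> = (\<Sum>e\<in>exps k. \<beta> e * (\<Prod>j\<in>UNIV. (y $ j) ^ e j))"
      by (subst sum.swap) (simp add: \<beta>_def sum_distrib_right)
    finally show ?thesis .
  qed
qed

section \<open>From cells to boxes and cubes\<close>

text \<open>A box of side \<open>q * L\<close> splits into \<open>q ^ CARD('d)\<close> cells of side
  \<open>L\<close>, each a translate of the cell at the origin.\<close>

lemma card_box_le:
  fixes F :: "'d::finite int_mpoly" and n :: "'d \<Rightarrow> int" and L k q :: nat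
  assumes hi: "\<And>i. mon_deg i > k \<Longrightarrow> m dvd Poly_Mapping.lookup F i"
    and i0: "mon_deg i0 = k" "coprime (Poly_Mapping.lookup F i0) m"
    and L: "L > 0"
    and small: "int (\<Prod>e\<in>(exps k :: ('d \<Rightarrow> nat) set). card (exps k :: ('d \<Rightarrow> nat) set) * L ^ sum e UNIV) < m"
  defines "X \<equiv> {x :: int ^ 'd. [eval_mpoly F x = 0] (mod m) \<and> (\<forall>j. n j \<le> x $ j \<and> x $ j < n j + int (q * L))}"
  shows "finite X" "card X * L \<le> q ^ CARD('d) * (CARD('d) * k * L ^ CARD('d))"
proof -
  define Y where "Y a = {y :: int ^ 'd. (\<forall>j. y $ j \<in> {0..<int L}) \<and> [eval_mpoly F (a + y) = 0] (mod m)}" for a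
  have Y: "finite (Y a)" "card (Y a) * L \<le> CARD('d) * k * L ^ CARD('d)" for a
  proof -
    obtain \<beta> where \<beta>: "\<beta> (vec_nth i0) = Poly_Mapping.lookup F i0"
      "\<And>y. [eval_mpoly F (a + y) = (\<Sum>e\<in>exps k. \<beta> e * (\<Prod>j\<in>UNIV. (y $ j) ^ e j))] (mod m)"
      using eval_mpoly_shift[OF hi i0(1)] by metis
    define Z where "Z = {y. (\<forall>j. y j \<in> {0..<int L}) \<and>
      [(\<Sum>e\<in>(exps k :: ('d \<Rightarrow> nat) set). \<beta> e * (\<Prod>j\<in>UNIV. y j ^ e j)) = 0] (mod m)}"
    have "Z \<subseteq> PiE UNIV (\<lambda>_. {0..<int L})" by (auto simp: Z_def)
    then have finZ: "finite Z" by (rule finite_subset) (simp add: finite_PiE)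
    have sub: "vec_nth ` Y a \<subseteq> Z"
      using cong_trans[OF cong_sym[OF \<beta>(2)]] by (auto simp: Y_def Z_def)
    have inj: "inj_on vec_nth (Y a)" by (simp add: inj_on_def vec_nth_inject)
    show "finite (Y a)" using inj sub finZ by (rule inj_on_finite)
    have "card (Y a) * L \<le> card Z * L" using inj sub finZ by (intro mult_le_mono1 card_inj_on_le)
    also have "\<dots> \<le> CARD('d) * k * L ^ CARD('d)"
      unfolding Z_def using card_small_box_le[of "vec_nth i0" k \<beta> m L] i0 \<beta>(1) L small
      by (simp add: exps_def mon_deg_def)
    finally show "card (Y a) * L \<le> CARD('d) * k * L ^ CARD('d)" .
  qed
  define S where "S = PiE (UNIV :: 'd set) (\<lambda>_. {..<q})"
  define a where "a t = (\<chi> j. n j + int L * int (t j))" for t :: "'d \<Rightarrow> nat"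
  have S: "finite S" "card S = q ^ CARD('d)"
    unfolding S_def by (simp_all add: finite_PiE card_PiE)
  have XU: "X \<subseteq> (\<Union>t\<in>S. (+) (a t) ` Y (a t))"
  proof
    \<comment> \<open>Division with remainder by \<open>L\<close> in each coordinate: the quotient
      names the cell, the remainder is the position in it.\<close>
    fix x assume x: "x \<in> X"
    define t where "t j = nat ((x $ j - n j) div int L)" for j
    define y where "y = (\<chi> j. (x $ j - n j) mod int L)"
    have t: "int (t j) = (x $ j - n j) div int L" for j
      using x L by (simp add: t_def X_def pos_imp_zdiv_nonneg_iff)
    have xay: "x = a t + y"
      by (simp add: vec_eq_iff a_def y_def t)
    have "t j < q" for j
    proof -
      have "int (t j) * int L \<le> x $ j - n j"
        unfolding t using L by (simp add: minus_mod_eq_div_mult[symmetric])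
      also have "\<dots> < int q * int L" using x by (simp add: X_def algebra_simps)
      finally show "t j < q" using L by (simp only: mult_less_cancel_right_pos of_nat_0_less_iff of_nat_less_iff)
    qed
    then have "t \<in> S" by (auto simp: S_def)
    moreover have "y \<in> Y (a t)" unfolding Y_def mem_Collect_eq xay[symmetric]
      using x L by (simp add: X_def) (simp add: y_def)
    ultimately show "x \<in> (\<Union>t\<in>S. (+) (a t) ` Y (a t))" using xay by blast
  qed
  have finU: "finite (\<Union>t\<in>S. (+) (a t) ` Y (a t))" using S Y(1) by auto
  then show "finite X" using XU by (rule finite_subset[rotated])
  have "card X * L \<le> (\<Sum>t\<in>S. card ((+) (a t) ` Y (a t))) * L"
    using card_mono[OF finU XU] card_UN_le[OF S(1), of "\<lambda>t. (+) (a t) ` Y (a t)"] by simp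
  also have "\<dots> \<le> (\<Sum>t\<in>S. card (Y (a t)) * L)"
    unfolding sum_distrib_right by (intro sum_mono mult_le_mono1 card_image_le Y)
  also have "\<dots> \<le> of_nat (card S) * (CARD('d) * k * L ^ CARD('d))"
    by (rule sum_bounded_above) (rule Y)
  finally show "card X * L \<le> q ^ CARD('d) * (CARD('d) * k * L ^ CARD('d))" using S by simp
qed

text \<open>Treats the four kinds of interval at once: the closed hull serves for counting, the open
  interior for bounding the side.\<close>

lemma interval_of_length_bounds:
  assumes "interval_of_length l I"
  shows "\<exists>a. I \<subseteq> {a..a + l} \<and> {a<..<a + l} \<subseteq> I"
proof -
  obtain a where "I \<in> {{a..a + l}, {a..<a + l}, {a<..a + l}, {a<..<a + l}}"
    using assms unfolding interval_of_length_def by blast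
  then have "I \<subseteq> {a..a + l} \<and> {a<..<a + l} \<subseteq> I" by auto
  then show ?thesis by blast
qed

text \<open>Supplies \<open>h \<ge> 1\<close>, hence \<open>m / h \<le> m\<close>, in the final
  estimate.\<close>

lemma cube_in_unit_cube_side_le:
  assumes "cube l (B :: (real ^ 'd::finite) set)" "B \<subseteq> cbox 0 1"
  shows "l \<le> 1"
proof (rule ccontr)
  assume "\<not> l \<le> 1"
  then have l: "l > 1" by simp
  obtain I where I: "\<And>j. interval_of_length l (I j)" "B = {x. \<forall>j. x $ j \<in> I j}"
    using assms(1) unfolding cube_def by auto
  obtain a where a: "\<And>j. {a j<..<a j + l} \<subseteq> I j"
    using interval_of_length_bounds[OF I(1)] by metis
  \<comment> \<open>The points at distance \<open>t\<close> from either end lie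
    \<open>(l + 1) / 2 > 1\<close> apart, too far for the unit interval.\<close>
  define t where "t = (l - 1) / 4"
  have "(\<chi> j. a j + s) \<in> cbox 0 1" if "0 < s" "s < l" for s
    using a that assms(2) unfolding I(2) by (force simp: subset_iff)
  from this[of t] this[of "l - t"] have "0 \<le> a j + t \<and> a j + (l - t) \<le> 1" for j
    using l by (auto simp: t_def mem_box_cart)
  from this[of undefined] show False using l by (auto simp: t_def field_simps)
qed

text \<open>The integer points in question lie in a box of side \<open>m * l\<close>, which about
  \<open>m * l / L\<close> cells cover in each direction.\<close>

lemma count_sols_cube_le:
  fixes F :: "'d::finite int_mpoly" and L k :: nat
  assumes hi: "\<And>i. mon_deg i > k \<Longrightarrow> m dvd Poly_Mapping.lookup F i"
    and i0: "mon_deg i0 = k" "coprime (Poly_Mapping.lookup F i0) m"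
    and L: "L > 0" "real L \<le> real_of_int m * l" and m: "m > 0"
    and small: "int (\<Prod>e\<in>(exps k :: ('d \<Rightarrow> nat) set). card (exps k :: ('d \<Rightarrow> nat) set) * L ^ sum e UNIV) < m"
    and B: "cube l B"
  shows "real (count_sols m F B) \<le> (2 ^ CARD('d) * CARD('d) * k) * (real_of_int m * l) ^ CARD('d) / L"
proof -
  let ?H = "real_of_int m * l"
  obtain I where I: "\<And>j. interval_of_length l (I j)" "B = {x. \<forall>j. x $ j \<in> I j}"
    using B unfolding cube_def by auto
  obtain a where a: "\<And>j. I j \<subseteq> {a j..a j + l}"
    using interval_of_length_bounds[OF I(1)] by metis
  define n where "n j = \<lceil>real_of_int m * a j\<rceil>" for j
  \<comment> \<open>The added 1 makes \<open>q * L\<close> exceed \<open>?H\<close> strictly, so the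
    half-open box also catches a closed right end. As \<open>?H / L \<ge> 1\<close>, this at most
    doubles the number, whence \<open>2 ^ CARD('d)\<close>.\<close>
  define q where "q = nat \<lfloor>?H / L\<rfloor> + 1"
  define X where "X = {x :: int ^ 'd. [eval_mpoly F x = 0] (mod m) \<and> (\<forall>j. n j \<le> x $ j \<and> x $ j < n j + int (q * L))}"
  have H: "?H / L \<ge> 1" using L by simp
  have q: "?H / L < real q" "real q \<le> 2 * (?H / L)"
  proof -
    have "z < real (nat \<lfloor>z\<rfloor> + 1) \<and> real (nat \<lfloor>z\<rfloor> + 1) \<le> 2 * z" if "z \<ge> 1" for z :: real
      using that by linarith
    then show "?H / L < real q" "real q \<le> 2 * (?H / L)" using H unfolding q_def by blast+
  qed
  have X: "finite X" "card X * L \<le> q ^ CARD('d) * (CARD('d) * k * L ^ CARD('d))"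
    unfolding X_def using card_box_le[OF hi i0 L(1) small, of n q] by blast+
  have "{x. [eval_mpoly F x = 0] (mod m) \<and> (\<chi> j. real_of_int (x $ j) / real_of_int m) \<in> B} \<subseteq> X"
  proof
    fix x assume x: "x \<in> {x. [eval_mpoly F x = 0] (mod m) \<and> (\<chi> j. real_of_int (x $ j) / real_of_int m) \<in> B}"
    have "n j \<le> x $ j \<and> x $ j < n j + int (q * L)" for j
    proof -
      have "a j \<le> real_of_int (x $ j) / real_of_int m" "real_of_int (x $ j) / real_of_int m \<le> a j + l"
        using x a[of j] by (auto simp: I(2))
      then have le: "real_of_int m * a j \<le> x $ j" "x $ j \<le> real_of_int m * a j + ?H"
        using m by (simp_all add: field_simps)
      have "?H < real q * L" using q(1) L by (simp add: field_simps)
      then have "real_of_int (x $ j) < real_of_int (n j + int (q * L))"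
        using le(2) le_of_int_ceiling[of "real_of_int m * a j"]
        unfolding n_def of_int_add of_nat_mult of_int_mult of_int_of_nat_eq by linarith
      moreover have "n j \<le> x $ j" unfolding n_def using le(1) by (simp add: ceiling_le_iff)
      ultimately show ?thesis by linarith
    qed
    then show "x \<in> X" using x by (simp add: X_def)
  qed
  then have "count_sols m F B \<le> card X" unfolding count_sols_def using X(1) by (rule card_mono[rotated])
  then have "real (count_sols m F B) * L \<le> real (card X * L)" by (simp add: mult_right_mono)
  also have "\<dots> \<le> real (q ^ CARD('d) * (CARD('d) * k * L ^ CARD('d)))"
    using X(2) of_nat_le_iff by blast
  also have "\<dots> = (CARD('d) * k) * (real q * L) ^ CARD('d)"
    by (simp add: power_mult_distrib mult_ac)
  also have "\<dots> \<le> (CARD('d) * k) * (2 * ?H) ^ CARD('d)"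
    using q(2) L by (intro mult_left_mono power_mono) (auto simp: field_simps)
  also have "\<dots> = (2 ^ CARD('d) * CARD('d) * k) * ?H ^ CARD('d)"
    by (simp add: power_mult_distrib)
  finally show ?thesis using L by (simp add: field_simps)
qed

section \<open>Choice of the cell size and the final exponents\<close>

theorem corollary3p2:
  fixes d k r :: nat
  assumes d: "d = CARD('d::finite)"
    and k: "k \<ge> 2"
    and r: "r = ((k + d) choose d) - 1"
  shows "\<forall>\<epsilon>::real. \<epsilon> > 0 \<longrightarrow> (\<exists>T::real.
           \<forall>(m::int) (h::real) (B :: (real ^ 'd) set) (F :: 'd int_mpoly).
             m > 2 \<longrightarrow> h > 0 \<longrightarrow> real_of_int m / h \<ge> T \<longrightarrow>
             cube (1 / h) B \<longrightarrow> B \<subseteq> cbox 0 1 \<longrightarrow>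
             deg_mod m F = k \<longrightarrow> top_gcd m F = 1 \<longrightarrow>
             (\<exists>e1 e2 e3 :: real. \<bar>e1\<bar> \<le> \<epsilon> \<and> \<bar>e2\<bar> \<le> \<epsilon> \<and> \<bar>e3\<bar> \<le> \<epsilon> \<and>
                real (count_sols m F B) \<le>
                  (real_of_int m / h) powr (real d - real k / (2 * real r * (real k + 1)) + e1)
                  + real_of_int m powr (real d - 1 / (2 * real r * (real k + 1)) + e2)
                    * (1 / h) powr (real d + e3)))"
proof (intro allI impI)
  fix \<epsilon> :: real assume \<epsilon>: "\<epsilon> > 0"
  define S where "S = 2 * real r * (real k + 1)"
  \<comment> \<open>\<open>A\<close> bounds the constant part of the pigeonhole product, and
    \<open>C\<close> is the constant of the cube count. In \<open>T\<close>, the entry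
    \<open>2 * A\<close> ensures that a cell of side at least 1 fits; the other lets an
    \<open>\<epsilon>\<close>-th power absorb \<open>4 * C * A\<close>.\<close>
  define A where "A = (real r + 1) ^ (r + 1)"
  define C where "C = 2 ^ d * real d * real k"
  define T where "T = max (2 * A) ((4 * C * A) powr (1 / \<epsilon>))"
  let ?E = "exps k :: ('d \<Rightarrow> nat) set"
  have "d > 0" using d by simp
  then obtain d' where d': "d = Suc d'" by (cases d) auto
  \<comment> \<open>Pascal's rule shows that the binomial coefficient is at least 2, so
    \<open>r \<ge> 1\<close> and \<open>S\<close> is positive.\<close>
  have "(k + d) choose d = ((k + d') choose d') + ((k + d') choose d)"
    by (simp add: d')
  moreover have "(k + d') choose d' > 0" "(k + d') choose d > 0" using k d' by simp_all
  ultimately have r1: "r \<ge> 1" and rE: "card ?E \<le> r + 1" "card ?E - 1 \<le> r"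
    using card_exps_le[where 'd='d and k=k] unfolding r d by linarith+
  have A1: "A \<ge> 1" unfolding A_def by (rule one_le_power) simp
  have C1: "C \<ge> 1"
  proof -
    have "1 \<le> 2 ^ d * d * k" using k d' by (simp add: Suc_le_eq)
    then have "real 1 \<le> real (2 ^ d * d * k)" by (rule of_nat_mono)
    then show ?thesis by (simp add: C_def)
  qed
  have S: "S \<ge> 1" "real k \<le> S"
  proof -
    have "real 1 * real k \<le> real (2 * r) * real (k + 1)" using r1 by (intro mult_mono) auto
    then show "real k \<le> S" by (simp add: S_def add.commute)
    then show "S \<ge> 1" using k by simp
  qed
  show "\<exists>T::real. \<forall>(m::int) (h::real) (B :: (real ^ 'd) set) (F :: 'd int_mpoly).
             m > 2 \<longrightarrow> h > 0 \<longrightarrow> real_of_int m / h \<ge> T \<longrightarrow>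
             cube (1 / h) B \<longrightarrow> B \<subseteq> cbox 0 1 \<longrightarrow>
             deg_mod m F = k \<longrightarrow> top_gcd m F = 1 \<longrightarrow>
             (\<exists>e1 e2 e3 :: real. \<bar>e1\<bar> \<le> \<epsilon> \<and> \<bar>e2\<bar> \<le> \<epsilon> \<and> \<bar>e3\<bar> \<le> \<epsilon> \<and>
                real (count_sols m F B) \<le>
                  (real_of_int m / h) powr (real d - real k / (2 * real r * (real k + 1)) + e1)
                  + real_of_int m powr (real d - 1 / (2 * real r * (real k + 1)) + e2)
                    * (1 / h) powr (real d + e3))"
  proof (rule exI[of _ T], intro allI impI)
    fix m :: int and h :: real and B :: "(real ^ 'd) set" and F :: "'d int_mpoly"
    assume m: "m > 2" and h: "h > 0" and T: "real_of_int m / h \<ge> T"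
      and B: "cube (1 / h) B" "B \<subseteq> cbox 0 1"
      and deg: "deg_mod m F = k" and top: "top_gcd m F = 1"
    define H where "H = real_of_int m / h"
    have "1 / h \<le> 1" using cube_in_unit_cube_side_le[OF B] .
    then have h1: "h \<ge> 1" using h by (simp add: field_simps)
    have mH: "real_of_int m \<ge> H" unfolding H_def using h1 m by (simp add: field_simps mult_le_cancel_left1)
    have HA: "H \<ge> 2 * A" and HC: "H \<ge> (4 * C * A) powr (1 / \<epsilon>)"
      using T unfolding H_def T_def by auto
    have H1: "H \<ge> 1" and mA: "real_of_int m \<ge> 2 * A" using HA A1 mH by linarith+
    have "4 * C * A = ((4 * C * A) powr (1 / \<epsilon>)) powr \<epsilon>"
      using \<epsilon> A1 C1 by (simp add: powr_powr)
    also have "\<dots> \<le> H powr \<epsilon>" using \<epsilon> HC by (intro powr_mono2) auto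
    finally have H\<epsilon>: "4 * C * A \<le> H powr \<epsilon>" .
    also have "\<dots> \<le> m powr \<epsilon>" using \<epsilon> mH H1 by (intro powr_mono2) auto
    finally have m\<epsilon>: "4 * C * A \<le> m powr \<epsilon>" .

    have fin: "finite {i :: nat ^ 'd. \<not> m dvd Poly_Mapping.lookup F i}"
      by (rule finite_subset[OF _ finite_keys[of F]]) (auto simp: in_keys_iff)
    have hi: "m dvd Poly_Mapping.lookup F i" if "mon_deg i > k" for i
    proof (rule ccontr)
      assume "\<not> ?thesis"
      then have "mon_deg i \<le> deg_mod m F" unfolding deg_mod_def using fin by (intro Max_ge) auto
      then show False using that deg by simp
    qed
    have "{i :: nat ^ 'd. mon_deg i = k} \<subseteq> vec_lambda ` ?E"
    proof
      fix i :: "nat ^ 'd" assume "i \<in> {i. mon_deg i = k}"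
      then have "vec_nth i \<in> ?E" by (simp add: exps_def mon_deg_def)
      then show "i \<in> vec_lambda ` ?E" by (metis image_eqI vec_nth_inverse)
    qed
    then have fin_top: "finite {i :: nat ^ 'd. mon_deg i = k}"
      using finite_exps finite_surj by blast
    \<comment> \<open>A pure power of one variable shows that the minimum in \<open>top_gcd\<close>
      is over a nonempty set, so it is attained.\<close>
    have "mon_deg (\<chi> j::'d. if j = undefined then k else 0) = k"
      by (simp add: mon_deg_def)
    then have "{i :: nat ^ 'd. mon_deg i = k} \<noteq> {}" by blast
    then have "top_gcd m F \<in> (\<lambda>i. gcd m (Poly_Mapping.lookup F i)) ` {i. mon_deg i = k}"
      unfolding top_gcd_def deg using fin_top by (intro Min_in) auto
    then obtain i0 where i0: "mon_deg i0 = k" "coprime (Poly_Mapping.lookup F i0) m"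
      using top by (auto simp: coprime_iff_gcd_eq_1 gcd.commute)

    \<comment> \<open>The first entry keeps a cell no larger than the box; the second gives
      \<open>A * X powr S \<le> m / 2\<close>, where the 2 provides strict smallness.\<close>
    define X where "X = min H ((m / (2 * A)) powr (1 / S))"
    define L where "L = nat \<lfloor>X\<rfloor>"
    have "X \<ge> 1" unfolding X_def using H1 mA A1 S by (simp add: ge_one_powr_ge_zero)
    then have L: "L \<ge> 1" "L \<le> X" "X < real L + 1" unfolding L_def by linarith+
    have "(\<Sum>e\<in>?E. sum e UNIV) \<le> k * r"
      using sum_exps_le[where 'd='d and k=k] rE(2) by (meson le_trans mult_le_mono2)
    then have exps: "(\<Sum>e\<in>?E. sum e UNIV) \<le> 2 * r * (k + 1)"
      by (simp add: algebra_simps)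
    have "(\<Prod>e\<in>?E. card ?E * L ^ sum e UNIV) \<le> (r + 1) ^ (r + 1) * L ^ (2 * r * (k + 1))"
    proof -
      have "card ?E ^ card ?E \<le> (r + 1) ^ card ?E" using rE by (intro power_mono) auto
      also have "\<dots> \<le> (r + 1) ^ (r + 1)" using rE by (intro power_increasing) auto
      finally have "card ?E ^ card ?E * L ^ (\<Sum>e\<in>?E. sum e UNIV) \<le> (r + 1) ^ (r + 1) * L ^ (2 * r * (k + 1))"
        using exps L by (intro mult_le_mono power_increasing) auto
      then show ?thesis by (simp add: prod.distrib power_sum)
    qed
    then have "real (\<Prod>e\<in>?E. card ?E * L ^ sum e UNIV) \<le> real ((r + 1) ^ (r + 1) * L ^ (2 * r * (k + 1)))"
      using of_nat_le_iff by blast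
    also have "\<dots> = A * real L powr S"
      using L by (simp add: A_def S_def powr_realpow[symmetric] algebra_simps)
    also have "\<dots> \<le> A * (((m / (2 * A)) powr (1 / S)) powr S)"
      using L A1 S unfolding X_def by (intro mult_left_mono powr_mono2) auto
    also have "\<dots> = m / 2" using S m A1 by (simp add: powr_powr)
    also have "\<dots> < m" using m by simp
    finally have small: "int (\<Prod>e\<in>?E. card ?E * L ^ sum e UNIV) < m" by linarith

    have "real (count_sols m F B) \<le> C * H ^ d / L"
      using count_sols_cube_le[OF hi i0, of L "1 / h" B] L m small B(1)
      unfolding C_def H_def d X_def by simp
    \<comment> \<open>Rounding down costs at most a factor 2, because \<open>L \<ge> 1\<close> and
      \<open>X < L + 1\<close>.\<close>
    also have "\<dots> \<le> C * H ^ d / (X / 2)"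
      using L C1 H1 by (intro divide_left_mono) auto
    also have "\<dots> = 2 * C * H ^ d * (1 / X)" by simp
    \<comment> \<open>The reciprocal of a minimum is one of the two reciprocals, hence at most their
      sum; \<open>S \<ge> 1\<close> gives \<open>(2 * A) powr (1 / S) \<le> 2 * A\<close>.\<close>
    also have "\<dots> \<le> 2 * C * H ^ d * (1 / H + 2 * A * m powr (- 1 / S))"
    proof (intro mult_left_mono)
      have "((m / (2 * A)) powr (1 / S)) = m powr (1 / S) / (2 * A) powr (1 / S)"
        by (rule powr_divide)
      then have "1 / ((m / (2 * A)) powr (1 / S)) = (2 * A) powr (1 / S) * m powr (- 1 / S)"
        by (simp add: powr_minus field_simps)
      also have "\<dots> \<le> (2 * A) powr 1 * m powr (- 1 / S)"
        using A1 S by (intro mult_right_mono powr_mono) auto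
      finally have "1 / ((m / (2 * A)) powr (1 / S)) \<le> 2 * A * m powr (- 1 / S)" using A1 by simp
      moreover have "0 \<le> 1 / H" "0 \<le> 2 * A * m powr (- 1 / S)" using H1 A1 by auto
      moreover have "1 / X = 1 / H \<or> 1 / X = 1 / ((m / (2 * A)) powr (1 / S))"
        unfolding X_def min_def by simp
      ultimately show "1 / X \<le> 1 / H + 2 * A * m powr (- 1 / S)"
        by linarith
    qed (use C1 H1 in auto)
    also have "\<dots> = 2 * C * (H ^ d / H) + 4 * C * A * (H ^ d * m powr (- 1 / S))"
      by (simp add: algebra_simps)
    \<comment> \<open>The constants go into the powers with exponent \<open>\<epsilon>\<close>, and
      \<open>k \<le> S\<close> weakens \<open>d - 1\<close> to \<open>d - k / S\<close>.\<close>
    also have "\<dots> \<le> H powr \<epsilon> * H powr (real d - real k / S)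
        + m powr \<epsilon> * (H ^ d * m powr (- 1 / S))"
    proof (intro add_mono mult_mono)
      have "2 * C * 1 \<le> (2 * C) * (2 * A)" using A1 C1 by (intro mult_left_mono) auto
      then show "2 * C \<le> H powr \<epsilon>" using H\<epsilon> by linarith
      have "H ^ d / H = H powr (real d - 1)"
        using H1 by (simp add: powr_diff powr_realpow)
      also have "\<dots> \<le> H powr (real d - real k / S)"
        using H1 S by (intro powr_mono) auto
      finally show "H ^ d / H \<le> H powr (real d - real k / S)" .
    qed (use H1 m\<epsilon> in auto)
    \<comment> \<open>Writing \<open>H ^ d\<close> as a power of \<open>m\<close> times one of
      \<open>1 / h\<close> gives the required shape, with errors \<open>\<epsilon>\<close>,
      \<open>\<epsilon>\<close> and 0.\<close>
    also have "\<dots> = H powr (real d - real k / S + \<epsilon>)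
        + m powr (real d - 1 / S + \<epsilon>) * (1 / h) powr (real d + 0)"
    proof -
      have "H ^ d = m powr d * (1 / h) powr d"
        using m h by (simp add: H_def powr_realpow power_divide)
      then have "m powr \<epsilon> * (H ^ d * m powr (- 1 / S))
          = (m powr d * m powr (- 1 / S) * m powr \<epsilon>) * (1 / h) powr (real d + 0)"
        by (simp only: mult_ac add_0_right)
      moreover have "m powr d * m powr (- 1 / S) * m powr \<epsilon> = m powr (real d - 1 / S + \<epsilon>)"
        by (simp flip: powr_add)
      moreover have "H powr \<epsilon> * H powr (real d - real k / S) = H powr (real d - real k / S + \<epsilon>)"
        by (simp add: add.commute flip: powr_add)
      ultimately show ?thesis by (simp only:)
    qed
    finally show "\<exists>e1 e2 e3 :: real. \<bar>e1\<bar> \<le> \<epsilon> \<and> \<bar>e2\<bar> \<le> \<epsilon> \<and> \<bar>e3\<bar> \<le> \<epsilon> \<and>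
                real (count_sols m F B) \<le>
                  (real_of_int m / h) powr (real d - real k / (2 * real r * (real k + 1)) + e1)
                  + real_of_int m powr (real d - 1 / (2 * real r * (real k + 1)) + e2)
                    * (1 / h) powr (real d + e3)"
      using \<epsilon> unfolding H_def S_def
      by (intro exI[of _ \<epsilon>] exI[of _ 0] conjI) simp_all
  qed
qed

end
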